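(* Let $k\ge 1$ be an integer and let $G$ be a finite non-abelian simple group of order $n\ge k!$. Then $G$ has no proper subgroup $H$ of index $[G:H]\le k$. Thus, every non-trivial conjugacy class of $G$ has size at least $k+1$.
   Context: A conjugacy class is called non-trivial if it has more than one element (equivalently, here, if it is not the class $\{1\}$ of the identity). *)

theory Defs
  imports "HOL-Algebra.Algebra"
begin

(* Cosets are counted with card, so infinite index gives the value 0. *)
definition subgroup_index :: "('a, 'b) monoid_scheme \<Rightarrow> 'a set \<Rightarrow> nat" where
  "subgroup_index G H = card (rcosets\<^bsub>G\<^esub> H)"

(* Orbits of the conjugation action, in the form used by group.action_by_conjugation. *)
definition conjugacy_classes :: "('a, 'b) monoid_scheme \<Rightarrow> 'a set set" where
  "conjugacy_classes G =
     orbits G (carrier G) (\<lambda>g. \<lambda>h \<in> carrier G. g \<otimes>\<^bsub>G\<^esub> h \<otimes>\<^bsub>G\<^esub> (inv\<^bsub>G\<^esub> g))"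

end

theory Submission
  imports Defs "HOL-Algebra.Sym_Groups"
begin

text \<open>
  Suppose that \<open>G\<close> is simple and non-abelian, and acts on a finite set \<open>E\<close> with
  \<open>(card E)! \<le> order G\<close>. If the action is not trivial, then its kernel, a normal subgroup, is
  trivial, so \<open>G\<close> embeds into the symmetric group of \<open>E\<close>. That group has \<open>(card E)!\<close> elements,
  hence \<open>G\<close> embeds onto all of it. Counting alone thus leaves the case of equality, and here the
  sign of a permutation decides: the sign is a homomorphism from \<open>G\<close> to the abelian
  group \<open>{-1, 1}\<close>, which must be trivial on a non-abelian simple group, whereas a set with two
  distinct points has a transposition, of sign \<open>-1\<close>. So every such action is trivial
  (\<open>small_action_trivial\<close>).

  A subgroup \<open>H\<close> of index at most \<open>k\<close> gives the action of \<open>G\<close> by right translation on the cosets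
  of \<open>H\<close>. As it is trivial, it fixes the coset \<open>H\<close>, which forces \<open>H = G\<close>. Finally, a conjugacy
  class has as many elements as the centralizer of any of its members has cosets, and this
  centralizer is a proper subgroup when the class is non-trivial.
\<close>

section \<open>Homomorphisms from a simple group\<close>

lemma (in simple_group) hom_inj_or_trivial:
  assumes "group_hom G K f"
  shows "inj_on f (carrier G) \<or> (\<forall>g\<in>carrier G. f g = \<one>\<^bsub>K\<^esub>)"
proof -
  interpret group_hom G K f by fact
  show ?thesis
    using no_real_normal_subgroup[OF normal_kernel] inj_iff_trivial_ker
    by (auto simp: kernel_def)
qed

text \<open>An injective homomorphism into an abelian group would make the domain abelian.\<close>

lemma (in simple_group) hom_to_comm_group_trivial:
  assumes "\<not> comm_group G" and "comm_group K" and "group_hom G K f" and "g \<in> carrier G"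
  shows "f g = \<one>\<^bsub>K\<^esub>"
proof -
  interpret group_hom G K f by fact
  interpret K: comm_group K by fact
  have "\<not> inj_on f (carrier G)"
  proof
    assume inj: "inj_on f (carrier G)"
    have "x \<otimes> y = y \<otimes> x" if "x \<in> carrier G" "y \<in> carrier G" for x y
      by (rule inj_onD[OF inj]) (use that in \<open>auto simp: K.m_comm\<close>)
    then have "comm_group G"
      by (rule group.group_comm_groupI[OF group_hom.axioms(1)[OF assms(3)]])
    with assms(1) show False by contradiction
  qed
  then show ?thesis
    using hom_inj_or_trivial[OF assms(3)] assms(4) by blast
qed

section \<open>The symmetric group of a finite set and the sign\<close>

text \<open>
  Elements of \<^term>\<open>Bij S\<close> are \<^term>\<open>undefined\<close> outside \<open>S\<close>, while the sign and the predicate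
  \<open>permutes\<close> expect functions that fix every point outside \<open>S\<close>.
\<close>

definition extend_by_id :: "'b set \<Rightarrow> ('b \<Rightarrow> 'b) \<Rightarrow> 'b \<Rightarrow> 'b" where
  "extend_by_id S f = (\<lambda>x. if x \<in> S then f x else x)"

lemma extend_by_id_permutes:
  assumes "f \<in> Bij S"
  shows "extend_by_id S f permutes S"
proof (rule bij_imp_permutes)
  show "bij_betw (extend_by_id S f) S S"
    using assms bij_betw_cong[of S f "extend_by_id S f" S]
    by (auto simp: Bij_def extend_by_id_def)
qed (simp add: extend_by_id_def)

lemma extend_by_id_compose:
  assumes "g \<in> Bij S"
  shows "extend_by_id S (compose S f g) = extend_by_id S f \<circ> extend_by_id S g"
  using Bij_imp_funcset[OF assms]
  by (auto simp: extend_by_id_def compose_def fun_eq_iff Pi_iff)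

lemma restrict_extend_by_id:
  assumes "f \<in> Bij S"
  shows "restrict (extend_by_id S f) S = f"
  using Bij_imp_extensional[OF assms]
  by (auto simp: extend_by_id_def fun_eq_iff extensional_def)

lemma permutes_restrict_in_Bij:
  assumes "p permutes S"
  shows "restrict p S \<in> Bij S"
  using permutes_imp_bij[OF assms] by (simp add: Bij_def)

lemma extend_by_id_restrict:
  assumes "p permutes S"
  shows "extend_by_id S (restrict p S) = p"
  using assms by (auto simp: extend_by_id_def fun_eq_iff permutes_def)

lemma bij_betw_extend_by_id: "bij_betw (extend_by_id S) (Bij S) {p. p permutes S}"
  by (rule bij_betwI[where g = "\<lambda>p. restrict p S"])
     (auto simp: extend_by_id_permutes permutes_restrict_in_Bij
        restrict_extend_by_id extend_by_id_restrict)

lemma card_Bij: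
  assumes "finite S"
  shows "card (Bij S) = fact (card S)"
  using bij_betw_same_card[OF bij_betw_extend_by_id] card_permutations[OF refl assms] by metis

lemma finite_Bij:
  assumes "finite S"
  shows "finite (Bij S)"
  using bij_betw_finite[OF bij_betw_extend_by_id] finite_permutations[OF assms] by metis

lemma comm_group_sign_img: "comm_group sign_img"
  by (rule group.group_comm_groupI[OF sign_img_is_group]) (auto simp: sign_img_def)

lemma sign_group_hom_Bij:
  assumes "finite S"
  shows "group_hom (BijGroup S) sign_img (\<lambda>f. sign (extend_by_id S f))"
proof -
  have "permutation (extend_by_id S f)" if "f \<in> Bij S" for f
    using extend_by_id_permutes[OF that] permutation_permutes assms by blast
  then have "(\<lambda>f. sign (extend_by_id S f)) \<in> hom (BijGroup S) sign_img"
    by (auto simp: hom_def BijGroup_def sign_img_def extend_by_id_compose sign_compose)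
       (auto simp: sign_def)
  then show ?thesis
    by (simp add: group_hom_def group_hom_axioms_def group_BijGroup sign_img_is_group)
qed

section \<open>Actions on small sets\<close>

text \<open>
  The factorial bound forces a non-trivial action to realise every permutation of \<open>E\<close>, odd ones
  included, and the sign excludes those.
\<close>

lemma (in simple_group) small_action_trivial:
  assumes "\<not> comm_group G" and "finite (carrier G)"
    and "group_action G E \<phi>" and "finite E" and "fact (card E) \<le> order G"
    and "g \<in> carrier G" and "x \<in> E"
  shows "\<phi> g x = x"
proof (rule ccontr)
  assume moved: "\<phi> g x \<noteq> x"
  interpret group_action G E \<phi> by fact
  have hom: "group_hom G (BijGroup E) \<phi>"
    by (rule group_hom)
  have inj: "inj_on \<phi> (carrier G)"
    using hom_inj_or_trivial[OF hom] moved assms(6,7) by (auto simp: BijGroup_def)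
  have onto: "\<phi> ` carrier G = Bij E"
  proof (rule card_seteq)
    show "card (Bij E) \<le> card (\<phi> ` carrier G)"
      using assms(5) card_image[OF inj] by (simp add: card_Bij assms(4) order_def)
  qed (use bij_prop0 finite_Bij[OF assms(4)] in auto)
  \<comment> \<open>The two points \<open>x\<close> and \<open>\<phi> g x\<close> supply a transposition, and it comes from \<open>G\<close>.\<close>
  define t where "t = transpose x (\<phi> g x)"
  have t: "t permutes E"
    unfolding t_def using assms(7) element_image[OF assms(6,7) refl] by (rule permutes_swap_id)
  then obtain h where h: "h \<in> carrier G" "\<phi> h = restrict t E"
    using permutes_restrict_in_Bij[OF t] onto by (metis imageE)
  interpret S: group_hom "BijGroup E" sign_img "\<lambda>f. sign (extend_by_id E f)"
    by (rule sign_group_hom_Bij[OF assms(4)])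
  have "group_hom G sign_img ((\<lambda>f. sign (extend_by_id E f)) \<circ> \<phi>)"
    using Group.hom_compose[OF group_hom.homh[OF hom] S.homh]
    by (simp add: group_hom_def group_hom_axioms_def sign_img_is_group)
  from hom_to_comm_group_trivial[OF assms(1) comm_group_sign_img this h(1)]
  have "sign t = (1::int)"
    by (simp add: h(2) extend_by_id_restrict[OF t] sign_img_def)
  moreover have "sign t = (-1::int)"
    using moved by (auto simp: t_def sign_swap_id)
  ultimately show False by simp
qed

section \<open>The action on cosets\<close>

text \<open>The inverse turns translation from the right into an action from the left.\<close>

lemma (in group) action_on_rcosets:
  assumes H: "subgroup H G"
  shows "group_action G (rcosets H) (\<lambda>g. \<lambda>R\<in>rcosets H. R #> inv g)"
proof -
  have sub: "R \<subseteq> carrier G" if "R \<in> rcosets H" for R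
    using that rcosets_subset_PowG[OF H] by blast
  have closed: "R #> g \<in> rcosets H" if "R \<in> rcosets H" "g \<in> carrier G" for R g
    using that subgroup.subset[OF H] by (auto simp: RCOSETS_def coset_mult_assoc)
  have Bij: "(\<lambda>R\<in>rcosets H. R #> inv g) \<in> Bij (rcosets H)" if "g \<in> carrier G" for g
  proof -
    have "bij_betw (\<lambda>R\<in>rcosets H. R #> inv g) (rcosets H) (rcosets H)"
      by (rule bij_betwI[where g = "\<lambda>R. R #> g"])
         (use that in \<open>auto simp: closed coset_mult_assoc sub\<close>)
    then show ?thesis by (simp add: Bij_def)
  qed
  have "(\<lambda>g. \<lambda>R\<in>rcosets H. R #> inv g) \<in> hom G (BijGroup (rcosets H))"
    by (auto simp: hom_def BijGroup_def Bij compose_def fun_eq_iff closed coset_mult_assoc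
        sub inv_mult_group)
  then show ?thesis
    by (simp add: group_action_def group_hom_def group_hom_axioms_def group_BijGroup)
qed

lemma (in simple_group) index_lower_bound:
  assumes "\<not> comm_group G" and "finite (carrier G)" and "fact k \<le> order G"
    and H: "subgroup H G" "H \<noteq> carrier G"
  shows "k < subgroup_index G H"
proof (rule ccontr)
  assume "\<not> k < subgroup_index G H"
  then have "fact (card (rcosets H)) \<le> (fact k :: nat)"
    by (intro fact_mono) (simp add: subgroup_index_def)
  with assms(3) have small: "fact (card (rcosets H)) \<le> order G"
    by simp
  have fin: "finite (rcosets H)"
    using rcosets_subset_PowG[OF H(1)] assms(2) by (meson finite_Pow_iff finite_subset)
  have H_coset: "H \<in> rcosets H"
    by (rule subgroup.subgroup_in_rcosets[OF H(1)]) (rule is_group)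
  have "g \<in> H" if "g \<in> carrier G" for g
    using small_action_trivial[OF assms(1,2) action_on_rcosets[OF H(1)] fin small
        inv_closed[OF that] H_coset] that H_coset coset_join1[OF _ that H(1)]
    by simp
  with H subgroup.subset[OF H(1)] show False by blast
qed

section \<open>Conjugacy classes\<close>

lemma (in group_action) card_orbit_eq_index_stabilizer:
  assumes "finite (carrier G)" and "x \<in> E"
  shows "card (orbit G \<phi> x) = subgroup_index G (stabilizer G \<phi> x)"
proof -
  interpret group G using group_hom by (simp add: group_hom_def)
  have st: "subgroup (stabilizer G \<phi> x) G"
    by (rule stabilizer_subgroup[OF assms(2)])
  have "card (stabilizer G \<phi> x) > 0"
    using subgroup.finite_imp_card_positive[OF st assms(1)] .
  then show ?thesis
    using orbit_stabilizer_theorem[OF assms(2)] lagrange[OF st]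
    by (metis mult_right_cancel less_not_refl subgroup_index_def)
qed

theorem proposition20:
  fixes G :: "('a, 'b) monoid_scheme" and k :: nat
  assumes "k \<ge> 1"
    and "simple_group G"
    and "finite (carrier G)"
    and "\<not> comm_group G"
    and "order G \<ge> fact k"
  shows "(\<nexists>H. subgroup H G \<and> H \<noteq> carrier G \<and> subgroup_index G H \<le> k) \<and>
         (\<forall>C \<in> conjugacy_classes G. card C > 1 \<longrightarrow> card C \<ge> k + 1)"
proof (intro conjI ballI impI)
  interpret simple_group G by fact
  note bound = index_lower_bound[OF assms(4,3,5)]
  show "\<nexists>H. subgroup H G \<and> H \<noteq> carrier G \<and> subgroup_index G H \<le> k"
    using bound by (meson not_less)
  fix C assume "C \<in> conjugacy_classes G" and C: "card C > 1"
  define \<phi> where "\<phi> = (\<lambda>g. \<lambda>h \<in> carrier G. g \<otimes>\<^bsub>G\<^esub> h \<otimes>\<^bsub>G\<^esub> (inv\<^bsub>G\<^esub> g))"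
  interpret conj: group_action G "carrier G" \<phi>
    unfolding \<phi>_def by (rule action_by_conjugation)
  obtain x where x: "x \<in> carrier G" "C = orbit G \<phi> x"
    using \<open>C \<in> conjugacy_classes G\<close> by (auto simp: conjugacy_classes_def orbits_def \<phi>_def)
  have "stabilizer G \<phi> x \<noteq> carrier G"
  proof
    assume "stabilizer G \<phi> x = carrier G"
    then have "C \<subseteq> {x}"
      by (auto simp: x(2) orbit_def stabilizer_def)
    then have "card C \<le> 1"
      using card_mono[of "{x}" C] by simp
    with C show False by simp
  qed
  then show "card C \<ge> k + 1"
    using bound[OF conj.stabilizer_subgroup[OF x(1)]]
      conj.card_orbit_eq_index_stabilizer[OF assms(3) x(1)] x(2)
    by simp
qed

end
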